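(* Consider an MTDC system whose line resistances are $\tilde R_{ij}=\gamma R_{ij}$, $(i,j)\in\mathcal{E}$, with scaling factor $\gamma>0$, controlled by the droop controller $u_i=-K_i^P(V_i-V_i^{\text{nom}})$, $K_i^P>0$, $i\in\mathcal{V}$, and let $K^P=\operatorname{diag}(K_1^P,\dots,K_n^P)$. In the limit when the line resistances go to zero, i.e. $\gamma\to0$, the current-sharing objective is satisfied for the cost matrix $F=\operatorname{diag}(f_1,\dots,f_n)$ with $F^{-1}=K^P$. That is, for every constant $I^{\text{inj}}\in\mathbb{R}^n$ and every initial voltage $V(0)$, denoting by $u^\gamma(t)$ the controlled injected currents along the closed-loop solution with scaling $\gamma$, $$\lim_{\gamma\to0^+}\ \lim_{t\to\infty}u^\gamma(t)=u^*,$$ where $u^*$ is the optimal current injection for $f_i=1/K_i^P$.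
   Context: MTDC system: let $\mathcal{G}$ be a fixed, undirected, connected graph with vertex set $\mathcal{V}=\{1,\dots,n\}$ (terminals) and edge set $\mathcal{E}$ (lines); the neighbours of $i$ are $\mathcal{N}_i$. Each edge $(i,j)$ has a base resistance $R_{ij}=R_{ji}>0$ and each terminal has capacitance $C_i>0$. With resistances $\gamma R_{ij}$ the voltages obey $C_i\dot V_i=-\sum_{j\in\mathcal{N}_i}\frac{1}{\gamma R_{ij}}(V_i-V_j)+I_i^{\text{inj}}+u_i$ for $i\in\mathcal{V}$, where $I_i^{\text{inj}}$ is a constant uncontrolled injected current and $u_i$ is the controlled injected current. Let $\mathcal{L}_R$ be the weighted graph Laplacian with edge weights $1/R_{ij}$, so that $\gamma^{-1}\mathcal{L}_R$ is the Laplacian of the scaled system. The nominal voltages are equal: $V_i^{\text{nom}}=V_j^{\text{nom}}$ for all $i,j\in\mathcal{V}$. Current-sharing objective with cost coefficients $f_i>0$: the controlled currents converge as $t\to\infty$ to $u^*$, where $u^*$ is the (unique) $u$-component of a minimizer $[u^*,V^*]$ of $\sum_{i\in\mathcal{V}}\frac12f_iu_i^2$ over $[u,V]\in\mathbb{R}^n\times\mathbb{R}^n$ subject to $\gamma^{-1}\mathcal{L}_RV=I^{\text{inj}}+u$. The vector $u^*$ does not depend on $\gamma>0$, since the factor $\gamma^{-1}$ can be absorbed into $V$. *)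

theory Defs
  imports "HOL-Analysis.Analysis"
begin

text \<open>
  Terminals are the elements of a finite type. An undirected graph is a symmetric irreflexive
  relation \<open>E\<close>, so every line occurs in both orientations; \<open>R i j\<close> is only meaningful for
  \<open>(i, j) \<in> E\<close>.
\<close>

definition neighbours :: "('n \<times> 'n) set \<Rightarrow> 'n \<Rightarrow> 'n set" where
  "neighbours E i = {j. (i, j) \<in> E}"

definition laplacian :: "('n::finite \<times> 'n) set \<Rightarrow> ('n \<Rightarrow> 'n \<Rightarrow> real) \<Rightarrow> real ^ 'n ^ 'n" where
  "laplacian E R = (\<chi> i j. if i = j then \<Sum>k\<in>neighbours E i. 1 / R i k
                           else if (i, j) \<in> E then - (1 / R i j) else 0)"

text \<open>
  \<open>V\<close> is a solution on \<open>[0, \<infinity>)\<close> (one-sided derivative at \<open>0\<close>) of the voltage dynamics with line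
  resistances \<open>\<gamma> * R i j\<close>, capacitances \<open>C\<close>, constant uncontrolled injection \<open>I\<close> and controlled
  injection \<open>u\<close>. The values of \<open>V\<close> at negative times are unconstrained.
\<close>

definition mtdc_solution ::
  "('n::finite \<times> 'n) set \<Rightarrow> ('n \<Rightarrow> 'n \<Rightarrow> real) \<Rightarrow> real ^ 'n \<Rightarrow> real \<Rightarrow> real ^ 'n
    \<Rightarrow> (real \<Rightarrow> real ^ 'n) \<Rightarrow> (real \<Rightarrow> real ^ 'n) \<Rightarrow> bool" where
  "mtdc_solution E R C \<gamma> I u V \<longleftrightarrow>
    (\<forall>t\<ge>0. \<exists>D. (V has_vector_derivative D) (at t within {0..}) \<and>
      (\<forall>i. C $ i * D $ i =
        - (\<Sum>j\<in>neighbours E i. 1 / (\<gamma> * R i j) * (V t $ i - V t $ j)) + I $ i + u t $ i))"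

definition droop_control :: "real ^ 'n \<Rightarrow> real ^ 'n \<Rightarrow> real ^ 'n \<Rightarrow> real ^ 'n" where
  "droop_control K Vnom V = (\<chi> i. - K $ i * (V $ i - Vnom $ i))"

definition droop_solution ::
  "('n::finite \<times> 'n) set \<Rightarrow> ('n \<Rightarrow> 'n \<Rightarrow> real) \<Rightarrow> real ^ 'n \<Rightarrow> real \<Rightarrow> real ^ 'n
    \<Rightarrow> real ^ 'n \<Rightarrow> real ^ 'n \<Rightarrow> (real \<Rightarrow> real ^ 'n) \<Rightarrow> bool" where
  "droop_solution E R C \<gamma> I K Vnom V \<longleftrightarrow>
    mtdc_solution E R C \<gamma> I (\<lambda>t. droop_control K Vnom (V t)) V"

definition optimal_injection ::
  "('n::finite \<times> 'n) set \<Rightarrow> ('n \<Rightarrow> 'n \<Rightarrow> real) \<Rightarrow> real \<Rightarrow> real ^ 'n \<Rightarrow> real ^ 'n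
    \<Rightarrow> real ^ 'n \<Rightarrow> bool" where
  "optimal_injection E R \<gamma> I f u \<longleftrightarrow>
    (\<exists>V. is_arg_min (\<lambda>(u, V). \<Sum>i\<in>UNIV. 1 / 2 * f $ i * (u $ i)\<^sup>2)
           (\<lambda>(u, V). (1 / \<gamma>) *\<^sub>R (laplacian E R *v V) = I + u) (u, V))"

end

theory Submission
  imports Defs
begin

text \<open>
  Write \<open>L\<close> for the Laplacian and \<open>A \<gamma>\<close> for \<open>\<gamma>\<inverse> L + diag K\<close>. Equal nominal voltages lie in the
  kernel of \<open>L\<close>, so the closed loop is the linear system \<open>C W' = - A \<gamma> W\<close> for the deviation \<open>W\<close>
  from the equilibrium \<open>Vnom + x\<close>, where \<open>A \<gamma> x = I\<close>. As \<open>A \<gamma>\<close> is positive definite, this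
  equilibrium exists (lemma \<open>surj_A\<close>), and the energy \<open>\<Sum>\<^sub>i C\<^sub>i W\<^sub>i\<^sup>2\<close> decays exponentially
  (lemma \<open>dissipative_flow_tendsto_zero\<close>). Hence the controlled currents tend to \<open>- K x\<close>.

  On the optimization side, connectedness makes the range of \<open>L\<close> the set of vectors with sum zero
  (lemma \<open>L_range\<close>). The constraint therefore only prescribes the total controlled current, and the
  optimum shares this total in proportion to \<open>K\<close>: it is \<open>- s K\<close> with \<open>s = (\<Sum>\<^sub>j I\<^sub>j) / (\<Sum>\<^sub>j K\<^sub>j)\<close>
  (lemma \<open>optimal_injection_iff\<close>).

  It remains to see that \<open>x\<close> tends to the constant vector \<open>s\<close> as \<open>\<gamma>\<close> tends to \<open>0\<close>. Intuitively, the
  term \<open>\<gamma>\<inverse> L\<close> penalizes voltage differences until only the constant part of \<open>x\<close> survives, and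
  current balance fixes that part. Lemma \<open>offset_tendsto\<close> makes this quantitative by an energy
  estimate with error of order \<open>\<surd>\<gamma>\<close>.
\<close>

section \<open>Linear differential equations\<close>

text \<open>
  The solution is the exponential series of \<open>f\<close> applied to the initial value. Each coordinate of
  that series is an ordinary real power series, so it may be differentiated term by term.
\<close>

lemma linear_ode_solution_exists:
  fixes f :: "'a::euclidean_space \<Rightarrow> 'a"
  assumes "linear f"
  shows "\<exists>w. w 0 = x \<and> (\<forall>t. (w has_vector_derivative f (w t)) (at t))"
proof -
  define s where "s t k = (t ^ k / fact k) *\<^sub>R (f ^^ k) x" for t :: real and k
  define w where "w t = (\<Sum>k. s t k)" for t
  obtain B where B: "B > 0" "\<And>v. norm (f v) \<le> B * norm v"
    using linear_bounded_pos[OF assms] by blast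
  have iter: "norm ((f ^^ k) x) \<le> B ^ k * norm x" for k
  proof (induction k)
    case (Suc k)
    have "norm ((f ^^ Suc k) x) \<le> B * norm ((f ^^ k) x)"
      using B(2) by simp
    also have "\<dots> \<le> B * (B ^ k * norm x)"
      using Suc B(1) by (intro mult_left_mono) auto
    finally show ?case by (simp add: mult.assoc)
  qed simp
  have summable_s: "summable (s t)" for t
  proof (rule summable_comparison_test')
    show "summable (\<lambda>k. inverse (fact k) * (\<bar>t\<bar> * B) ^ k * norm x)"
      by (intro summable_mult2 summable_exp)
    show "norm (s t k) \<le> inverse (fact k) * (\<bar>t\<bar> * B) ^ k * norm x" for k
    proof -
      have "norm (s t k) = \<bar>t\<bar> ^ k / fact k * norm ((f ^^ k) x)"
        by (simp add: s_def power_abs)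
      also have "\<dots> \<le> \<bar>t\<bar> ^ k / fact k * (B ^ k * norm x)"
        by (intro mult_left_mono iter) auto
      finally show ?thesis by (simp add: power_mult_distrib field_simps)
    qed
  qed
  have "(w has_vector_derivative f (w t)) (at t)" for t
    unfolding has_vector_derivative_def
  proof (subst has_derivative_componentwise_within, intro ballI)
    fix b :: 'a assume "b \<in> Basis"
    define c where "c k = ((f ^^ k) x \<bullet> b) / fact k" for k
    have coord: "(\<lambda>k. c k * t ^ k) sums (w t \<bullet> b)" for t
    proof -
      have "(\<lambda>k. s t k \<bullet> b) sums (w t \<bullet> b)"
        unfolding w_def
        by (rule bounded_linear.sums[OF bounded_linear_inner_left summable_sums[OF summable_s]])
      then show ?thesis by (simp add: s_def c_def mult.commute)
    qed
    have "(\<lambda>k. f (s t k) \<bullet> b) sums (f (w t) \<bullet> b)"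
      unfolding w_def
      by (intro bounded_linear.sums[OF bounded_linear_inner_left]
          bounded_linear.sums[OF linear_linear[THEN iffD2, OF assms]] summable_sums[OF summable_s])
    moreover have "f (s t k) \<bullet> b = diffs c k * t ^ k" for k
      by (simp add: s_def c_def diffs_def linear_scale[OF assms] field_simps del: of_nat_Suc)
    ultimately have deriv: "(\<Sum>k. diffs c k * t ^ k) = f (w t) \<bullet> b"
      by (simp add: sums_iff)
    have "((\<lambda>t. \<Sum>k. c k * t ^ k) has_real_derivative (\<Sum>k. diffs c k * t ^ k)) (at t)"
      by (rule termdiffs_strong_converges_everywhere) (use coord in \<open>auto simp: sums_iff\<close>)
    moreover have "(\<lambda>t. \<Sum>k. c k * t ^ k) = (\<lambda>t. w t \<bullet> b)"
      using coord by (auto simp: sums_iff)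
    ultimately show "((\<lambda>t. w t \<bullet> b) has_derivative (\<lambda>h. h *\<^sub>R f (w t) \<bullet> b)) (at t)"
      by (simp add: deriv has_field_derivative_def mult.commute[of _ "f (w t) \<bullet> b"])
  qed
  moreover have "w 0 = x"
  proof -
    have "s 0 = (\<lambda>k. if k = 0 then x else 0)"
      by (auto simp: s_def)
    then show ?thesis
      using sums_unique[OF sums_single[of 0 "\<lambda>_. x"]] by (simp add: w_def)
  qed
  ultimately show ?thesis by blast
qed

lemma exponential_decay:
  fixes S :: "real \<Rightarrow> real"
  assumes deriv: "\<And>t. t \<ge> 0 \<Longrightarrow> (S has_real_derivative S' t) (at t within {0..})"
    and decay: "\<And>t. t \<ge> 0 \<Longrightarrow> S' t \<le> - a * S t"
    and "T \<ge> 0"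
  shows "S T \<le> S 0 * exp (- a * T)"
proof -
  define g where "g t = S t * exp (a * t)" for t
  have g: "(g has_real_derivative (S' t + a * S t) * exp (a * t)) (at t within {0..})"
    if "t \<ge> 0" for t
    unfolding g_def
    by (rule derivative_eq_intros deriv[OF that] refl | simp add: algebra_simps)+
  have "g T \<le> g 0"
  proof (rule DERIV_nonpos_imp_decreasing_open[OF \<open>T \<ge> 0\<close>])
    fix t :: real assume t: "0 < t" "t < T"
    have "at t within {0..} = at t"
      by (rule at_within_interior) (use t in simp)
    moreover have "(S' t + a * S t) * exp (a * t) \<le> 0"
      using decay[of t] t by (intro mult_nonpos_nonneg) auto
    ultimately show "\<exists>y. (g has_real_derivative y) (at t) \<and> y \<le> 0"
      using g[of t] t by auto
  next
    show "continuous_on {0..T} g"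
      by (rule continuous_on_subset[OF DERIV_continuous_on[where s = "{0..}"]]) (use g in auto)
  qed
  then show ?thesis
    by (simp add: g_def exp_minus field_simps)
qed

text \<open>
  The weighted energy \<open>\<Sum>\<^sub>i C\<^sub>i W\<^sub>i\<^sup>2\<close> is a Lyapunov function: it decays at
  the rate \<open>2 min\<^sub>i K\<^sub>i / C\<^sub>i\<close>.
\<close>

lemma dissipative_flow_tendsto_zero:
  fixes W :: "real \<Rightarrow> real ^ 'n" and A :: "real ^ 'n \<Rightarrow> real ^ 'n" and C K :: "real ^ 'n"
  assumes C: "\<And>i. C $ i > 0" and K: "\<And>i. K $ i > 0"
    and coercive: "\<And>x. (\<Sum>i\<in>UNIV. K $ i * (x $ i)\<^sup>2) \<le> x \<bullet> A x"
    and deriv: "\<And>t. t \<ge> 0 \<Longrightarrow>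
      (W has_vector_derivative (\<chi> i. - A (W t) $ i / C $ i)) (at t within {0..})"
  shows "(W \<longlongrightarrow> 0) at_top"
proof -
  define a where "a = Min (range (\<lambda>i. K $ i / C $ i))"
  have "a > 0"
    using C K by (auto simp: a_def)
  have a: "a * C $ i \<le> K $ i" for i
  proof -
    have "a \<le> K $ i / C $ i" by (simp add: a_def)
    then show ?thesis using C[of i] by (simp add: field_simps)
  qed
  define S where "S t = (\<Sum>i\<in>UNIV. C $ i * (W t $ i)\<^sup>2)" for t
  have S: "(S has_real_derivative - 2 * (W t \<bullet> A (W t))) (at t within {0..})" if "t \<ge> 0" for t
  proof -
    have W_i: "((\<lambda>t. W t $ i) has_real_derivative (- A (W t) $ i / C $ i)) (at t within {0..})" for i
      using bounded_linear.has_vector_derivative[OF bounded_linear_vec_nth deriv[OF that], of i]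
      by (simp add: has_real_derivative_iff_has_vector_derivative)
    have "(S has_real_derivative
        (\<Sum>i\<in>UNIV. C $ i * (2 * W t $ i * (- A (W t) $ i / C $ i)))) (at t within {0..})"
      unfolding S_def
      by (intro DERIV_sum DERIV_cmult) (auto intro!: derivative_eq_intros W_i)
    also have "(\<Sum>i\<in>UNIV. C $ i * (2 * W t $ i * (- A (W t) $ i / C $ i)))
        = - 2 * (W t \<bullet> A (W t))"
    proof -
      have "C $ i * (2 * W t $ i * (- A (W t) $ i / C $ i)) = - 2 * (W t $ i * A (W t) $ i)" for i
        using C[of i] by simp
      then show ?thesis
        by (simp only: inner_vec_def sum_distrib_left inner_real_def)
    qed
    finally show ?thesis .
  qed
  have S_decay: "S t \<le> S 0 * exp (- (2 * a) * t)" if "t \<ge> 0" for t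
  proof (rule exponential_decay[OF S _ that])
    fix t :: real
    have "a * S t \<le> (\<Sum>i\<in>UNIV. K $ i * (W t $ i)\<^sup>2)"
      unfolding S_def sum_distrib_left
      by (rule sum_mono) (use a in \<open>simp add: mult_right_mono flip: mult.assoc\<close>)
    with coercive[of "W t"] show "- 2 * (W t \<bullet> A (W t)) \<le> - (2 * a) * S t"
      by simp
  qed
  show ?thesis
  proof (rule vec_tendstoI)
    fix i
    have bound: "norm (W t $ i) \<le> sqrt (S 0 * exp (- (2 * a) * t) / C $ i)" if "t \<ge> 0" for t
    proof -
      have "C $ i * (W t $ i)\<^sup>2 \<le> S t"
        unfolding S_def
        by (rule member_le_sum) (auto intro!: mult_nonneg_nonneg less_imp_le[OF C])
      with S_decay[OF that] have "(W t $ i)\<^sup>2 \<le> S 0 * exp (- (2 * a) * t) / C $ i"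
        using C[of i] by (simp add: field_simps)
      from real_sqrt_le_mono[OF this] show ?thesis by simp
    qed
    have "((\<lambda>t. exp (- (2 * a) * t)) \<longlongrightarrow> 0) at_top"
      by (rule filterlim_compose[OF exp_at_bot filterlim_tendsto_neg_mult_at_bot[OF tendsto_const]])
        (use \<open>a > 0\<close> in \<open>simp_all add: filterlim_ident\<close>)
    from tendsto_real_sqrt[OF tendsto_divide[OF tendsto_mult[OF tendsto_const[of "S 0"] this]
          tendsto_const[of "C $ i"]]]
    have "((\<lambda>t. sqrt (S 0 * exp (- (2 * a) * t) / C $ i)) \<longlongrightarrow> 0) at_top"
      using C[of i] by simp
    then show "((\<lambda>t. W t $ i) \<longlongrightarrow> 0 $ i) at_top"
      unfolding zero_index
      by (rule Lim_null_comparison[rotated])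
        (use bound in \<open>auto intro: eventually_at_top_linorderI[of 0]\<close>)
  qed
qed

section \<open>The Laplacian of a resistive network\<close>

lemma positive_definite_imp_surj:
  fixes f :: "'a::euclidean_space \<Rightarrow> 'a"
  assumes "linear f" and "\<And>x. x \<noteq> 0 \<Longrightarrow> x \<bullet> f x > 0"
  shows "surj f"
proof (rule linear_injective_imp_surjective[OF assms(1)])
  show "inj f"
    unfolding linear_injective_0[OF assms(1)] using assms(2) by fastforce
qed auto

locale resistive_network =
  fixes E :: "('n::finite \<times> 'n) set" and R :: "'n \<Rightarrow> 'n \<Rightarrow> real"
  assumes sym_E: "sym E" and irrefl_E: "irrefl E" and connected: "E\<^sup>* = UNIV"
    and R_pos: "\<And>i j. (i, j) \<in> E \<Longrightarrow> R i j > 0"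
    and R_sym: "\<And>i j. (i, j) \<in> E \<Longrightarrow> R i j = R j i"
begin

abbreviation L :: "real ^ 'n \<Rightarrow> real ^ 'n" where
  "L x \<equiv> laplacian E R *v x"

lemma L_nth: "L x $ i = (\<Sum>j\<in>neighbours E i. 1 / R i j * (x $ i - x $ j))"
proof -
  have i: "i \<notin> neighbours E i"
    using irrefl_E by (auto simp: neighbours_def irrefl_def)
  have "L x $ i = (\<Sum>j\<in>UNIV. (if i = j then (\<Sum>k\<in>neighbours E i. 1 / R i k) * x $ j else 0)
      - (if j \<in> neighbours E i then 1 / R i j * x $ j else 0))"
    unfolding matrix_vector_mult_def laplacian_def
    by (simp, rule sum.cong) (use i in \<open>auto simp: neighbours_def\<close>)
  also have "\<dots> = (\<Sum>k\<in>neighbours E i. 1 / R i k) * x $ i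
      - (\<Sum>j\<in>neighbours E i. 1 / R i j * x $ j)"
    by (simp add: sum_subtractf sum.inter_restrict[symmetric] flip: sum.inter_filter)
  finally show ?thesis
    by (simp only: sum_distrib_right sum_subtractf right_diff_distrib)
qed

text \<open>
  Both orientations of a line occur in the sum over \<open>E\<close>, whence the factor \<open>1 / 2\<close>.
\<close>

lemma inner_L:
  "x \<bullet> L y = 1 / 2 * (\<Sum>(i, j)\<in>E. 1 / R i j * ((x $ i - x $ j) * (y $ i - y $ j)))"
proof -
  define g where "g i j = 1 / R i j * (x $ i * (y $ i - y $ j))" for i j
  have E: "E = Sigma UNIV (neighbours E)"
    by (auto simp: neighbours_def)
  have 1: "x \<bullet> L y = (\<Sum>(i, j)\<in>E. g i j)"
    by (subst E, subst sum.Sigma[symmetric])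
      (auto simp: inner_vec_def L_nth g_def sum_distrib_left mult_ac)
  also have "\<dots> = (\<Sum>(i, j)\<in>E. g j i)"
    by (rule sum.reindex_bij_witness[where i = prod.swap and j = prod.swap])
      (use sym_E in \<open>auto dest: symD\<close>)
  finally have 2: "x \<bullet> L y = (\<Sum>(i, j)\<in>E. g j i)" .
  have "2 * (x \<bullet> L y) = (\<Sum>(i, j)\<in>E. g i j + g j i)"
    using 1 2 by (simp add: case_prod_unfold sum.distrib)
  also have "\<dots> = (\<Sum>(i, j)\<in>E. 1 / R i j * ((x $ i - x $ j) * (y $ i - y $ j)))"
  proof (rule sum.cong[OF refl], clarify)
    fix i j assume "(i, j) \<in> E"
    then show "g i j + g j i = 1 / R i j * ((x $ i - x $ j) * (y $ i - y $ j))"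
      unfolding g_def R_sym[OF \<open>(i, j) \<in> E\<close>] by (simp add: algebra_simps)
  qed
  finally show ?thesis by simp
qed

lemma inner_L_commute: "x \<bullet> L y = y \<bullet> L x"
  unfolding inner_L by (simp add: mult.commute)

lemma inner_L_nonneg: "x \<bullet> L x \<ge> 0"
  unfolding inner_L
  by (intro mult_nonneg_nonneg sum_nonneg) (auto intro!: divide_nonneg_pos R_pos)

lemma inner_L_eq_0_imp_constant:
  assumes "x \<bullet> L x = 0"
  shows "x $ i = x $ j"
proof -
  have nonneg: "0 \<le> (case e of (i, j) \<Rightarrow> 1 / R i j * ((x $ i - x $ j) * (x $ i - x $ j)))"
    if "e \<in> E" for e
    using that by (cases e) (simp add: R_pos less_imp_le)
  have "\<forall>e\<in>E. (case e of (i, j) \<Rightarrow> 1 / R i j * ((x $ i - x $ j) * (x $ i - x $ j))) = 0"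
  proof (rule sum_nonneg_eq_0_iff[THEN iffD1])
    show "(\<Sum>(i, j)\<in>E. 1 / R i j * ((x $ i - x $ j) * (x $ i - x $ j))) = 0"
      using assms unfolding inner_L by simp
  qed (rule finite, rule nonneg)
  then have edge: "x $ i = x $ j" if "(i, j) \<in> E" for i j
    using that R_pos[OF that] by auto
  have "(i, j) \<in> E\<^sup>*" using connected by simp
  then show ?thesis
    by (induction rule: rtrancl_induct) (auto dest: edge)
qed

lemma L_constant: "L (\<chi> i. c) = 0"
  by (simp add: vec_eq_iff L_nth)

lemma sum_L: "(\<Sum>i\<in>UNIV. L x $ i) = 0"
proof -
  have "(\<Sum>i\<in>UNIV. L x $ i) = (\<chi> i. 1) \<bullet> L x"
    by (simp add: inner_vec_def)
  also have "\<dots> = 0"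
    by (simp add: inner_L_commute[of _ x] L_constant)
  finally show ?thesis .
qed

text \<open>
  Adding the all-ones matrix to the Laplacian makes it positive definite, hence onto; if the
  right-hand side has sum zero, then so does the preimage, and the added term vanishes there.
\<close>

lemma L_range:
  assumes "(\<Sum>i\<in>UNIV. b $ i) = 0"
  shows "\<exists>z. L z = b"
proof -
  define G where "G x = L x + (\<chi> i. \<Sum>j\<in>UNIV. x $ j)" for x :: "real ^ 'n"
  have "linear G"
    by (rule linearI)
      (simp_all add: G_def vec_eq_iff matrix_vector_right_distrib matrix_vector_mult_scaleR
        sum.distrib sum_distrib_left distrib_left)
  moreover have "x \<bullet> G x > 0" if "x \<noteq> 0" for x
  \<comment> \<open>Both summands of the quadratic form vanish only on a constant vector with sum zero.\<close>
  proof (rule ccontr)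
    have G: "x \<bullet> G x = x \<bullet> L x + (\<Sum>j\<in>UNIV. x $ j)\<^sup>2"
      by (simp add: G_def inner_vec_def power2_eq_square distrib_left sum.distrib
          flip: sum_distrib_right)
    assume "\<not> x \<bullet> G x > 0"
    with inner_L_nonneg[of x] have 0: "x \<bullet> L x = 0" "(\<Sum>j\<in>UNIV. x $ j) = 0"
      unfolding G by (smt (verit) zero_le_power2 power2_eq_iff_nonneg zero_eq_power2)+
    have "x $ i = 0" for i
    proof -
      have "(\<Sum>j\<in>UNIV. x $ j) = (\<Sum>j\<in>(UNIV :: 'n set). x $ i)"
        by (intro sum.cong refl inner_L_eq_0_imp_constant 0(1))
      with 0(2) show ?thesis by simp
    qed
    with that show False by (simp add: vec_eq_iff)
  qed
  ultimately have "surj G" by (rule positive_definite_imp_surj)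
  then obtain z where z: "G z = b" by (metis surjD)
  have "(\<Sum>i\<in>UNIV. G z $ i) = of_nat CARD('n) * (\<Sum>j\<in>UNIV. z $ j)"
    by (simp add: G_def sum.distrib sum_L)
  with z assms have "(\<Sum>j\<in>UNIV. z $ j) = 0" by simp
  with z have "L z = b" by (simp add: G_def vec_eq_iff)
  then show ?thesis ..
qed

end

section \<open>Optimal current injections\<close>

definition proportional_injection :: "real ^ 'n::finite \<Rightarrow> real ^ 'n \<Rightarrow> real ^ 'n" where
  "proportional_injection K I =
    (\<chi> i. - K $ i * ((\<Sum>j\<in>UNIV. I $ j) / (\<Sum>j\<in>UNIV. K $ j)))"

lemma sum_proportional_injection:
  assumes "\<And>i. K $ i > 0"
  shows "(\<Sum>i\<in>UNIV. proportional_injection K I $ i) = - (\<Sum>i\<in>UNIV. I $ i)"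
proof -
  have "(\<Sum>j\<in>UNIV. K $ j) > 0"
    using assms by (intro sum_pos) auto
  then show ?thesis
    by (simp add: proportional_injection_def sum_negf flip: sum_distrib_right sum_divide_distrib)
qed

text \<open>
  At the proportional injection the marginal costs \<open>u\<^sub>i / K\<^sub>i\<close> agree, so the first-order term of
  the cost vanishes in every direction with sum zero and only the quadratic term is left.
\<close>

lemma cost_excess:
  assumes K: "\<And>i. K $ i > 0" and u: "(\<Sum>i\<in>UNIV. u $ i) = - (\<Sum>i\<in>UNIV. I $ i)"
  shows "(\<Sum>i\<in>UNIV. 1 / 2 * (1 / K $ i) * (u $ i)\<^sup>2) =
    (\<Sum>i\<in>UNIV. 1 / 2 * (1 / K $ i) * (proportional_injection K I $ i)\<^sup>2) +
    (\<Sum>i\<in>UNIV. 1 / 2 * (1 / K $ i) * (u $ i - proportional_injection K I $ i)\<^sup>2)"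
proof -
  define v where "v = proportional_injection K I"
  define s where "s = (\<Sum>j\<in>UNIV. I $ j) / (\<Sum>j\<in>UNIV. K $ j)"
  have "1 / 2 * (1 / K $ i) * (u $ i)\<^sup>2 = 1 / 2 * (1 / K $ i) * (v $ i)\<^sup>2 +
      1 / 2 * (1 / K $ i) * (u $ i - v $ i)\<^sup>2 - s * (u $ i - v $ i)" for i
  proof -
    have v: "v $ i = - K $ i * s"
      by (simp add: v_def s_def proportional_injection_def)
    show ?thesis
      unfolding v using K[of i] by (simp add: field_simps power2_eq_square)
  qed
  then have "(\<Sum>i\<in>UNIV. 1 / 2 * (1 / K $ i) * (u $ i)\<^sup>2) =
      (\<Sum>i\<in>UNIV. 1 / 2 * (1 / K $ i) * (v $ i)\<^sup>2) +
      (\<Sum>i\<in>UNIV. 1 / 2 * (1 / K $ i) * (u $ i - v $ i)\<^sup>2) - s * (\<Sum>i\<in>UNIV. u $ i - v $ i)"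
    unfolding sum_distrib_left[of s] by (simp only: sum_subtractf sum.distrib)
  moreover have "(\<Sum>i\<in>UNIV. u $ i - v $ i) = 0"
    unfolding v_def sum_subtractf u sum_proportional_injection[OF K] by simp
  ultimately show ?thesis by (simp add: v_def)
qed

text \<open>
  The total of the net currents is the only obstruction to a choice of voltages that produces them.
\<close>

lemma (in resistive_network) feasible_iff:
  assumes "\<gamma> > 0"
  shows "(\<exists>V. (1 / \<gamma>) *\<^sub>R L V = I + u) \<longleftrightarrow> (\<Sum>i\<in>UNIV. u $ i) = - (\<Sum>i\<in>UNIV. I $ i)"
proof
  assume "\<exists>V. (1 / \<gamma>) *\<^sub>R L V = I + u"
  then obtain V where "(1 / \<gamma>) *\<^sub>R L V = I + u" ..
  then have "(\<Sum>i\<in>UNIV. (I + u) $ i) = (\<Sum>i\<in>UNIV. ((1 / \<gamma>) *\<^sub>R L V) $ i)"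
    by simp
  also have "\<dots> = 0"
    by (simp add: sum_L flip: sum_divide_distrib)
  finally show "(\<Sum>i\<in>UNIV. u $ i) = - (\<Sum>i\<in>UNIV. I $ i)"
    by (simp add: sum.distrib)
next
  assume "(\<Sum>i\<in>UNIV. u $ i) = - (\<Sum>i\<in>UNIV. I $ i)"
  then have "(\<Sum>i\<in>UNIV. (I + u) $ i) = 0"
    by (simp add: sum.distrib)
  then obtain z where "L z = I + u"
    using L_range by blast
  with assms have "(1 / \<gamma>) *\<^sub>R L (\<gamma> *\<^sub>R z) = I + u"
    by (simp add: matrix_vector_mult_scaleR)
  then show "\<exists>V. (1 / \<gamma>) *\<^sub>R L V = I + u" ..
qed

lemma (in resistive_network) optimal_injection_iff:
  assumes "\<gamma> > 0" and K: "\<And>i. K $ i > 0"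
  shows "optimal_injection E R \<gamma> I (\<chi> i. 1 / K $ i) u \<longleftrightarrow> u = proportional_injection K I"
proof -
  let ?v = "proportional_injection K I"
  define cost where "cost u = (\<Sum>i\<in>UNIV. 1 / 2 * (1 / K $ i) * (u $ i)\<^sup>2)" for u :: "real ^ 'n"
  define feasible where "feasible u \<longleftrightarrow> (\<Sum>i\<in>UNIV. u $ i) = - (\<Sum>i\<in>UNIV. I $ i)"
    for u :: "real ^ 'n"
  have feasible: "feasible u \<longleftrightarrow> (\<exists>V. (1 / \<gamma>) *\<^sub>R L V = I + u)" for u
    unfolding feasible_def using feasible_iff[OF \<open>\<gamma> > 0\<close>] by simp
  have v: "feasible ?v"
    unfolding feasible_def by (rule sum_proportional_injection[OF K])
  have excess: "cost u = cost ?v + cost (u - ?v)" if "feasible u" for u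
    using cost_excess[OF K that[unfolded feasible_def]] by (simp add: cost_def)
  have term_nonneg: "1 / 2 * (1 / K $ i) * (u $ i)\<^sup>2 \<ge> 0" for u :: "real ^ 'n" and i
    using K[of i] by simp
  have cost_nonneg: "cost u \<ge> 0" for u
    unfolding cost_def by (rule sum_nonneg) (rule term_nonneg)
  have cost_zero: "u = 0" if "cost u = 0" for u
  proof -
    have "\<forall>i\<in>UNIV. 1 / 2 * (1 / K $ i) * (u $ i)\<^sup>2 = 0"
    proof (rule sum_nonneg_eq_0_iff[THEN iffD1])
      show "(\<Sum>i\<in>UNIV. 1 / 2 * (1 / K $ i) * (u $ i)\<^sup>2) = 0"
        using that unfolding cost_def .
    qed (rule finite, rule term_nonneg)
    moreover have "K $ i \<noteq> 0" for i
      using K[of i] by simp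
    ultimately show ?thesis
      by (simp add: vec_eq_iff)
  qed
  have "optimal_injection E R \<gamma> I (\<chi> i. 1 / K $ i) u \<longleftrightarrow>
      feasible u \<and> (\<forall>w. feasible w \<longrightarrow> cost u \<le> cost w)"
    unfolding optimal_injection_def is_arg_min_linorder feasible split_paired_All prod.case vec_lambda_beta
      cost_def[symmetric] by blast
  also have "\<dots> \<longleftrightarrow> u = ?v"
  proof
    assume u: "feasible u \<and> (\<forall>w. feasible w \<longrightarrow> cost u \<le> cost w)"
    then have "cost u \<le> cost ?v" using v by blast
    with u excess[of u] cost_nonneg[of "u - ?v"] have "cost (u - ?v) = 0" by linarith
    then have "u - ?v = 0" by (rule cost_zero)
    then show "u = ?v" by simp
  next
    have "cost ?v \<le> cost w" if "feasible w" for w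
      using excess[OF that] cost_nonneg[of "w - ?v"] by linarith
    moreover assume "u = ?v"
    ultimately show "feasible u \<and> (\<forall>w. feasible w \<longrightarrow> cost u \<le> cost w)"
      using v by blast
  qed
  finally show ?thesis .
qed

section \<open>The droop-controlled network\<close>

locale droop_network = resistive_network E R
  for E :: "('n::finite \<times> 'n) set" and R +
  fixes K :: "real ^ 'n"
  assumes K_pos: "\<And>i. K $ i > 0"
begin

text \<open>
  The system matrix of the closed loop: the line currents and the droop currents that a voltage
  deviation causes.
\<close>

definition A :: "real \<Rightarrow> real ^ 'n \<Rightarrow> real ^ 'n" where
  "A \<gamma> x = (1 / \<gamma>) *\<^sub>R L x + (\<chi> i. K $ i * x $ i)"

lemma linear_A: "linear (A \<gamma>)"
  by (rule linearI)
    (simp_all add: A_def vec_eq_iff matrix_vector_right_distrib matrix_vector_mult_scaleR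
      add_divide_distrib algebra_simps)

lemma inner_A: "x \<bullet> A \<gamma> x = 1 / \<gamma> * (x \<bullet> L x) + (\<Sum>i\<in>UNIV. K $ i * (x $ i)\<^sup>2)"
proof -
  have "x \<bullet> (\<chi> i. K $ i * x $ i) = (\<Sum>i\<in>UNIV. K $ i * (x $ i)\<^sup>2)"
    by (simp add: inner_vec_def power2_eq_square mult_ac)
  then show ?thesis
    by (simp add: A_def inner_right_distrib)
qed

lemma A_coercive:
  assumes "\<gamma> > 0"
  shows "(\<Sum>i\<in>UNIV. K $ i * (x $ i)\<^sup>2) \<le> x \<bullet> A \<gamma> x"
  using assms inner_L_nonneg[of x] by (simp add: inner_A)

lemma surj_A:
  assumes "\<gamma> > 0"
  shows "surj (A \<gamma>)"
proof (rule positive_definite_imp_surj[OF linear_A])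
  fix x :: "real ^ 'n" assume "x \<noteq> 0"
  then obtain i where "x $ i \<noteq> 0" by (auto simp: vec_eq_iff)
  then have "0 < (\<Sum>i\<in>UNIV. K $ i * (x $ i)\<^sup>2)"
    by (intro sum_pos2[of _ i]) (auto intro!: mult_nonneg_nonneg mult_pos_pos less_imp_le[OF K_pos] K_pos)
  with A_coercive[OF assms] show "x \<bullet> A \<gamma> x > 0"
    by (rule less_le_trans[rotated])
qed

text \<open>
  The steady-state deviation of the voltages from their nominal values. Equal nominal voltages
  drive no current through the lines, so only the injected current enters its equation.
\<close>

definition offset :: "real ^ 'n \<Rightarrow> real \<Rightarrow> real ^ 'n" where
  "offset I \<gamma> = inv (A \<gamma>) I"

lemma A_offset: "\<gamma> > 0 \<Longrightarrow> A \<gamma> (offset I \<gamma>) = I"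
  unfolding offset_def by (rule surj_f_inv_f[OF surj_A])

lemma droop_solution_iff:
  assumes C: "\<And>i. C $ i > 0" and Vnom: "\<And>i j. Vnom $ i = Vnom $ j" and "\<gamma> > 0"
  shows "droop_solution E R C \<gamma> I K Vnom V \<longleftrightarrow>
    (\<forall>t\<ge>0. (V has_vector_derivative
      (\<chi> i. - A \<gamma> (V t - (Vnom + offset I \<gamma>)) $ i / C $ i)) (at t within {0..}))"
proof -
  have "Vnom = (\<chi> i. Vnom $ undefined)"
    using Vnom by (simp add: vec_eq_iff)
  then have L_Vnom: "L Vnom = 0"
    using L_constant by metis
  have rhs: "- (\<Sum>j\<in>neighbours E i. 1 / (\<gamma> * R i j) * (x $ i - x $ j)) + I $ i
      + droop_control K Vnom x $ i = - A \<gamma> (x - (Vnom + offset I \<gamma>)) $ i" for x :: "real ^ 'n" and i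
  proof -
    have "(\<Sum>j\<in>neighbours E i. 1 / (\<gamma> * R i j) * (x $ i - x $ j)) = 1 / \<gamma> * L x $ i"
      unfolding L_nth sum_distrib_left by simp
    moreover have "A \<gamma> (x - (Vnom + offset I \<gamma>)) $ i = A \<gamma> x $ i - A \<gamma> Vnom $ i - I $ i"
      by (simp add: linear_diff[OF linear_A] linear_add[OF linear_A] A_offset[OF \<open>\<gamma> > 0\<close>])
    moreover have "A \<gamma> Vnom $ i = K $ i * Vnom $ i"
      by (simp add: A_def L_Vnom)
    moreover have "A \<gamma> x $ i = 1 / \<gamma> * L x $ i + K $ i * x $ i"
      by (simp add: A_def)
    moreover have "droop_control K Vnom x $ i = K $ i * Vnom $ i - K $ i * x $ i"
      by (simp add: droop_control_def algebra_simps)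
    ultimately show ?thesis by linarith
  qed
  have "(\<forall>i. C $ i * D $ i = y $ i) \<longleftrightarrow> D = (\<chi> i. y $ i / C $ i)" for D y :: "real ^ 'n"
    using C by (auto simp: vec_eq_iff field_simps less_imp_neq[symmetric])
  from this[of _ "- A \<gamma> (_ - (Vnom + offset I \<gamma>))"] show ?thesis
    unfolding droop_solution_def mtdc_solution_def rhs by simp
qed

lemma droop_solution_exists:
  assumes C: "\<And>i. C $ i > 0" and Vnom: "\<And>i j. Vnom $ i = Vnom $ j" and "\<gamma> > 0"
  shows "\<exists>V. droop_solution E R C \<gamma> I K Vnom V \<and> V 0 = V0"
proof -
  define Ve where "Ve = Vnom + offset I \<gamma>"
  define f where "f x = (\<chi> i. - A \<gamma> x $ i / C $ i)" for x
  have "linear f"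
    by (rule linearI)
      (simp_all add: f_def vec_eq_iff linear_add[OF linear_A] linear_scale[OF linear_A]
        add_divide_distrib diff_divide_distrib)
  from linear_ode_solution_exists[OF this, of "V0 - Ve"] obtain w
    where w: "w 0 = V0 - Ve" "\<And>t. (w has_vector_derivative f (w t)) (at t)" by blast
  have "((\<lambda>t. w t + Ve) has_vector_derivative f (w t)) (at t within {0..})" for t
    using has_vector_derivative_at_within[OF w(2), of t]
    by (auto intro!: derivative_eq_intros)
  then have "droop_solution E R C \<gamma> I K Vnom (\<lambda>t. w t + Ve)"
    unfolding droop_solution_iff[OF assms] by (simp add: Ve_def[symmetric] f_def)
  with w(1) show ?thesis by (intro exI[of _ "\<lambda>t. w t + Ve"]) simp
qed

lemma droop_solution_tendsto:
  assumes C: "\<And>i. C $ i > 0" and Vnom: "\<And>i j. Vnom $ i = Vnom $ j" and "\<gamma> > 0"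
    and V: "droop_solution E R C \<gamma> I K Vnom V"
  shows "(V \<longlongrightarrow> Vnom + offset I \<gamma>) at_top"
proof -
  define Ve where "Ve = Vnom + offset I \<gamma>"
  have "((\<lambda>t. V t - Ve) \<longlongrightarrow> 0) at_top"
  proof (rule dissipative_flow_tendsto_zero[OF C K_pos A_coercive[OF \<open>\<gamma> > 0\<close>]])
    fix t :: real assume "t \<ge> 0"
    with V have "(V has_vector_derivative (\<chi> i. - A \<gamma> (V t - Ve) $ i / C $ i)) (at t within {0..})"
      unfolding droop_solution_iff[OF C Vnom \<open>\<gamma> > 0\<close>] Ve_def by blast
    then show "((\<lambda>t. V t - Ve) has_vector_derivative
        (\<chi> i. - A \<gamma> (V t - Ve) $ i / C $ i)) (at t within {0..})"
      by (auto intro!: derivative_eq_intros)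
  qed
  then show ?thesis
    unfolding Ve_def by (rule LIM_zero_cancel)
qed

text \<open>
  In the limit the offset becomes the constant \<open>s\<close> at which the droop currents balance the
  injected ones. The residual \<open>I - s K\<close> left by this constant has sum zero, so it is \<open>L z\<close>
  for some \<open>z\<close>, and the error \<open>y\<close> satisfies \<open>A \<gamma> y = L z\<close>. Pairing with \<open>y\<close> and completing
  the square in the Laplacian form bounds \<open>\<Sum>\<^sub>i K\<^sub>i y\<^sub>i\<^sup>2\<close> by \<open>\<gamma> / 4\<close> times the
  energy of \<open>z\<close>.
\<close>

lemma offset_tendsto:
  "(offset I \<longlongrightarrow> (\<chi> i. (\<Sum>j\<in>UNIV. I $ j) / (\<Sum>j\<in>UNIV. K $ j))) (at_right 0)"
proof -
  define s where "s = (\<Sum>j\<in>UNIV. I $ j) / (\<Sum>j\<in>UNIV. K $ j)"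
  have "(\<Sum>j\<in>UNIV. K $ j) > 0"
    using K_pos by (intro sum_pos) auto
  then have "(\<Sum>i\<in>UNIV. (I - s *\<^sub>R K) $ i) = 0"
    by (simp add: s_def sum_subtractf flip: sum_distrib_left sum_divide_distrib)
  then obtain z where z: "L z = I - s *\<^sub>R K"
    using L_range by blast
  have energy: "(\<Sum>i\<in>UNIV. K $ i * (offset I \<gamma> $ i - s)\<^sup>2) \<le> \<gamma> / 4 * (z \<bullet> L z)"
    if "\<gamma> > 0" for \<gamma>
  proof -
    define y where "y = offset I \<gamma> - (\<chi> i. s)"
    have "A \<gamma> (\<chi> i. s) = s *\<^sub>R K"
      by (simp add: A_def L_constant vec_eq_iff)
    then have "A \<gamma> y = L z"
      by (simp add: y_def linear_diff[OF linear_A] A_offset[OF that] z)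
    then have 1: "(\<Sum>i\<in>UNIV. K $ i * (y $ i)\<^sup>2) = y \<bullet> L z - 1 / \<gamma> * (y \<bullet> L y)"
      using inner_A[of y \<gamma>] by simp
    have expand: "(y - c *\<^sub>R z) \<bullet> L (y - c *\<^sub>R z) =
        y \<bullet> L y - 2 * c * (y \<bullet> L z) + c\<^sup>2 * (z \<bullet> L z)" for c
    proof -
      have "L (y - c *\<^sub>R z) = L y - c *\<^sub>R L z"
        by (simp only: matrix_vector_mult_diff_distrib matrix_vector_mult_scaleR)
      then have "(y - c *\<^sub>R z) \<bullet> L (y - c *\<^sub>R z) =
          y \<bullet> L y - c * (y \<bullet> L z) - c * (z \<bullet> L y - c * (z \<bullet> L z))"
        by (simp only: inner_diff_left inner_diff_right inner_scaleR_left inner_scaleR_right)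
          (simp add: right_diff_distrib)
      also have "z \<bullet> L y = y \<bullet> L z" by (rule inner_L_commute)
      finally show ?thesis
        by (simp only: power2_eq_square right_diff_distrib mult.assoc)
    qed
    \<comment> \<open>With the shift by \<open>(\<gamma> / 2) z\<close> the mixed term is \<open>- (y \<bullet> L z)\<close> and cancels the one in \<open>1\<close>.\<close>
    have "0 \<le> 1 / \<gamma> * ((y - (\<gamma> / 2) *\<^sub>R z) \<bullet> L (y - (\<gamma> / 2) *\<^sub>R z))"
      using that inner_L_nonneg by simp
    also have "\<dots> = 1 / \<gamma> * (y \<bullet> L y) - y \<bullet> L z + \<gamma> / 4 * (z \<bullet> L z)"
    proof -
      have "1 / \<gamma> * (p - 2 * (\<gamma> / 2) * q + (\<gamma> / 2)\<^sup>2 * r) = 1 / \<gamma> * p - q + \<gamma> / 4 * r" for p q r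
        using that by (simp add: power2_eq_square field_simps)
      then show ?thesis unfolding expand .
    qed
    finally have "(\<Sum>i\<in>UNIV. K $ i * (y $ i)\<^sup>2) \<le> \<gamma> / 4 * (z \<bullet> L z)"
      unfolding 1 by linarith
    then show ?thesis by (simp add: y_def)
  qed
  show ?thesis
    unfolding s_def[symmetric]
  proof (rule vec_tendstoI)
    fix i
    have bound: "norm (offset I \<gamma> $ i - s) \<le> sqrt (\<gamma> / 4 * (z \<bullet> L z) / K $ i)"
      if "\<gamma> > 0" for \<gamma>
    proof -
      have "K $ i * (offset I \<gamma> $ i - s)\<^sup>2 \<le> (\<Sum>i\<in>UNIV. K $ i * (offset I \<gamma> $ i - s)\<^sup>2)"
        by (rule member_le_sum) (auto intro!: mult_nonneg_nonneg less_imp_le[OF K_pos])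
      also have "\<dots> \<le> \<gamma> / 4 * (z \<bullet> L z)"
        by (rule energy[OF that])
      finally have "(offset I \<gamma> $ i - s)\<^sup>2 \<le> \<gamma> / 4 * (z \<bullet> L z) / K $ i"
        unfolding pos_le_divide_eq[OF K_pos] by (simp only: mult.commute)
      from real_sqrt_le_mono[OF this] show ?thesis by simp
    qed
    have "((\<lambda>\<gamma>. sqrt (\<gamma> / 4 * (z \<bullet> L z) / K $ i)) \<longlongrightarrow> sqrt (0 / 4 * (z \<bullet> L z) / K $ i))
        (at_right 0)"
      using K_pos[of i] by (intro tendsto_intros) auto
    then have bound_0: "((\<lambda>\<gamma>. sqrt (\<gamma> / 4 * (z \<bullet> L z) / K $ i)) \<longlongrightarrow> 0) (at_right 0)"
      by simp
    have "((\<lambda>\<gamma>. offset I \<gamma> $ i - s) \<longlongrightarrow> 0) (at_right 0)"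
      by (rule Lim_null_comparison[OF eventually_mono[OF eventually_at_right_less bound] bound_0])
    then have "((\<lambda>\<gamma>. offset I \<gamma> $ i) \<longlongrightarrow> s) (at_right 0)"
      by (rule LIM_zero_cancel)
    then show "((\<lambda>\<gamma>. offset I \<gamma> $ i) \<longlongrightarrow> (\<chi> i. s) $ i) (at_right 0)"
      by simp
  qed
qed

end

section \<open>Current sharing in the limit of vanishing resistances\<close>

theorem lemma3:
  fixes E :: "('n::finite \<times> 'n) set"
    and R :: "'n \<Rightarrow> 'n \<Rightarrow> real"
    and C K Vnom I :: "real ^ 'n"
  assumes "sym E" and "irrefl E" and connected: "E\<^sup>* = UNIV"
    and "\<And>i j. (i, j) \<in> E \<Longrightarrow> R i j > 0"
    and "\<And>i j. (i, j) \<in> E \<Longrightarrow> R i j = R j i"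
    and "\<And>i. C $ i > 0"
    and "\<And>i. K $ i > 0"
    and "\<And>i j. Vnom $ i = Vnom $ j"
  shows "\<exists>u_star.
    (\<forall>\<gamma>>0. \<forall>u. optimal_injection E R \<gamma> I (\<chi> i. 1 / K $ i) u \<longleftrightarrow> u = u_star) \<and>
    (\<forall>V0.
      (\<forall>\<gamma>>0. \<exists>V. droop_solution E R C \<gamma> I K Vnom V \<and> V 0 = V0) \<and>
      (\<forall>V. (\<forall>\<gamma>>0. droop_solution E R C \<gamma> I K Vnom (V \<gamma>) \<and> V \<gamma> 0 = V0) \<longrightarrow>
        (\<exists>u_inf.
          (\<forall>\<gamma>>0. ((\<lambda>t. droop_control K Vnom (V \<gamma> t)) \<longlongrightarrow> u_inf \<gamma>) at_top) \<and>
          (u_inf \<longlongrightarrow> u_star) (at_right 0))))"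
proof -
  interpret droop_network E R K
    by unfold_locales (use assms in auto)
  have control: "droop_control K Vnom (Vnom + x) = (\<chi> i. - K $ i * x $ i)" for x
    by (simp add: droop_control_def)
  have tendsto_control: "((\<lambda>t. droop_control K Vnom (V t)) \<longlongrightarrow> droop_control K Vnom x) F"
    if "(V \<longlongrightarrow> x) F" for V :: "real \<Rightarrow> real ^ 'n" and x F
    unfolding droop_control_def
    by (intro tendsto_vec_lambda tendsto_intros tendsto_vec_nth that)
  define u_inf where "u_inf \<gamma> = droop_control K Vnom (Vnom + offset I \<gamma>)" for \<gamma>
  have "(u_inf \<longlongrightarrow> droop_control K Vnom
      (Vnom + (\<chi> i. (\<Sum>j\<in>UNIV. I $ j) / (\<Sum>j\<in>UNIV. K $ j)))) (at_right 0)"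
    unfolding u_inf_def by (intro tendsto_control tendsto_intros offset_tendsto)
  then have u_inf: "(u_inf \<longlongrightarrow> proportional_injection K I) (at_right 0)"
    unfolding control by (simp add: proportional_injection_def)
  have limit: "((\<lambda>t. droop_control K Vnom (V t)) \<longlongrightarrow> u_inf \<gamma>) at_top"
    if "\<gamma> > 0" "droop_solution E R C \<gamma> I K Vnom V" for \<gamma> V
    unfolding u_inf_def
    by (rule tendsto_control[OF droop_solution_tendsto[OF assms(6,8) that]])
  show ?thesis
  proof (intro exI[of _ "proportional_injection K I"] conjI allI impI)
    fix \<gamma> :: real and u assume "\<gamma> > 0"
    then show "optimal_injection E R \<gamma> I (\<chi> i. 1 / K $ i) u \<longleftrightarrow>
        u = proportional_injection K I"
      by (rule optimal_injection_iff[OF _ assms(7)])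
  next
    fix V0 and \<gamma> :: real assume "\<gamma> > 0"
    then show "\<exists>V. droop_solution E R C \<gamma> I K Vnom V \<and> V 0 = V0"
      by (rule droop_solution_exists[OF assms(6,8)])
  next
    fix V0 V assume "\<forall>\<gamma>>0. droop_solution E R C \<gamma> I K Vnom (V \<gamma>) \<and> V \<gamma> 0 = V0"
    then have "((\<lambda>t. droop_control K Vnom (V \<gamma> t)) \<longlongrightarrow> u_inf \<gamma>) at_top"
      if "\<gamma> > 0" for \<gamma>
      using that by (intro limit) auto
    with u_inf show "\<exists>u_inf.
        (\<forall>\<gamma>>0. ((\<lambda>t. droop_control K Vnom (V \<gamma> t)) \<longlongrightarrow> u_inf \<gamma>) at_top) \<and>
        (u_inf \<longlongrightarrow> proportional_injection K I) (at_right 0)"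
      by (intro exI[of _ u_inf]) simp
  qed
qed

end
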